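(* Let $q\in\mathbb R$, $q\ne0$, $q^2\neq1$. Consider left invariant, right $\mathbb{CZ}$-invariant bimodule covariant derivatives $\nabla$ on $\Omega^1\mathbb C_q[SU_2]$, and say that $\nabla$ descends to the quantum sphere if it sends horizontal 1-forms to $\Omega^1\otimes(\text{horizontal 1-forms})$ and sends the forms on the quantum sphere (the horizontal $\mathbb{CZ}$-invariant 1-forms) into $(\text{horizontal})\otimes(\text{horizontal})$. If $\nabla$ descends to the quantum sphere then $$\nabla e^\pm=n_\pm\,e^0\otimes e^\pm,\qquad n_-=-(1+q^2),\quad n_+=q^{-4}(1+q^2),$$ and conversely any such $\nabla$ with these values descends (the value of $\nabla e^0$ being irrelevant). Consequently the connection induced on the quantum sphere is unique among those obtained in this way; moreover it is torsion free and preserves the Hermitian metric obtained by restricting a Hermitian metric $\mathrm{diag}(g_{++},g_{00},g_{--})$ from $\mathbb C_q[SU_2]$.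
   Context: **Algebra and calculus.** $A=\mathbb C_q[SU_2]$ is the unital $*$-algebra with generators $a,b,c,d$ and relations $ba=qab$, $ca=qac$, $db=qbd$, $dc=qcd$, $cb=bc$, $da-ad=q(1-q^{-2})bc$, $ad-q^{-1}bc=1$, with $a^*=d$, $d^*=a$, $c^*=-qb$, $b^*=-q^{-1}c$. Its 3D calculus: $\Omega^1A$ is the free left $A$-module on $e^+,e^0,e^-$, with bimodule relations $e^\pm a=qae^\pm$, $e^\pm c=qce^\pm$, $e^\pm b=q^{-1}be^\pm$, $e^\pm d=q^{-1}de^\pm$, $e^0a=q^2ae^0$, $e^0c=q^2ce^0$, $e^0b=q^{-2}be^0$, $e^0d=q^{-2}de^0$, and derivation $\mathrm da=ae^0+qbe^+$, $\mathrm db=ae^--q^{-2}be^0$, $\mathrm dc=ce^0+qde^+$, $\mathrm dd=ce^--q^{-2}de^0$. Star: antilinear, $(x\xi y)^*=y^*\xi^*x^*$, $(e^0)^*=-e^0$, $(e^+)^*=-q^{-1}e^-$, $(e^-)^*=-qe^+$. In $\Omega^2A$: $e^\pm\wedge e^\pm=e^0\wedge e^0=0$, $q^2e^+\wedge e^-+e^-\wedge e^+=0$, $e^0\wedge e^\pm+q^{\pm4}e^\pm\wedge e^0=0$; $\mathrm de^0=q^3e^+\wedge e^-$, $\mathrm de^\pm=\mp q^{\pm2}(1+q^{-2})e^\pm\wedge e^0$. **Sphere.** $\mathbb{CZ}$ is the group algebra of $(\mathbb Z,+)$ with grouplike generator $z$. It coacts on the right, multiplicatively, by $\rho(a)=a\otimes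 z$, $\rho(c)=c\otimes z$, $\rho(b)=b\otimes z^{-1}$, $\rho(d)=d\otimes z^{-1}$, $\rho(e^0)=e^0\otimes1$, $\rho(e^\pm)=e^\pm\otimes z^{\pm2}$. The quantum sphere algebra is $\{x\in A:\rho(x)=x\otimes1\}$. Horizontal 1-forms are those in $Ae^++Ae^-$. The 1-forms on the sphere are $\{xe^++ye^-:\rho(x)=x\otimes z^{-2},\ \rho(y)=y\otimes z^{2}\}$, with $\mathrm d$ and $\wedge$ restricted from $A$. **Connections.** A bimodule covariant derivative on $\Omega^1A$ is a linear map $\nabla:\Omega^1A\to\Omega^1A\otimes_A\Omega^1A$ with $\nabla(x\xi)=\mathrm dx\otimes\xi+x\nabla\xi$ for which there is a bimodule map $\sigma$ on $\Omega^1A\otimes_A\Omega^1A$ with $\nabla(\xi x)=\nabla(\xi)x+\sigma(\xi\otimes\mathrm dx)$. The left invariant, right $\mathbb{CZ}$-invariant ones are exactly those with $\nabla e^0=r\,e^0\otimes e^0+\nu\,e^+\otimes e^-+\mu\,e^-\otimes e^+$, $\nabla e^\pm=n_\pm\,e^0\otimes e^\pm+m_\pm\,e^\pm\otimes e^0$, for $r,\nu,\mu,n_\pm,m_\pm\in\mathbb C$. Torsion free means $\wedge\nabla=\mathrm d$ on 1-forms of the sphere. The Hermitian metric is $\langle xe^i,\overline{ye^j}\rangle=x\,g^{ij}\,y^*$ with $(g^{ij})$ the inverse of the diagonal matrix of nonzero real constants; $\nabla$ preserves it on the sphere means $\mathrm d\langle\xi,\overline\eta\rangle=(\mathrm{id}\otimes\langle\,,\rangle)(\nabla\xi\otimes\overline\eta)+(\langle\,,\rangle\otimes\mathrm{id})(\xi\otimes\hat\nabla\overline\eta)$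 for all 1-forms $\xi,\eta$ on the sphere, where $\hat\nabla\overline\eta=\overline{\eta_2}\otimes\eta_1^*$ if $\nabla\eta=\eta_1\otimes\eta_2$ (summation understood). *)

theory Defs
  imports
    "HOL-Analysis.Analysis"
    "HOL-Library.Poly_Mapping"
    "HOL-Computational_Algebra.Group_Closure"
begin

section \<open>The free complex algebra on four generators\<close>

datatype gen = Ga | Gb | Gc | Gd

datatype word = Word (letters: "gen list")

instantiation word :: monoid_add
begin

definition zero_word :: word where "0 = Word []"

definition plus_word :: "word \<Rightarrow> word \<Rightarrow> word" where
  "u + v = Word (letters u @ letters v)"

instance by standard (auto simp: zero_word_def plus_word_def)

end

text \<open>With concatenation as addition on words, the convolution product of
  \<^typ>\<open>word \<Rightarrow>\<^sub>0 complex\<close> is the product of the free algebra.\<close>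

type_synonym free_alg = "word \<Rightarrow>\<^sub>0 complex"

definition fgen :: "gen \<Rightarrow> free_alg" where
  "fgen g = Poly_Mapping.single (Word [g]) 1"

definition fconst :: "real \<Rightarrow> free_alg" where
  "fconst r = Poly_Mapping.single 0 (complex_of_real r)"

inductive_set two_sided_ideal :: "'r::ring_1 set \<Rightarrow> 'r set" for S :: "'r set" where
  zero: "0 \<in> two_sided_ideal S"
| base: "r \<in> S \<Longrightarrow> r \<in> two_sided_ideal S"
| add: "u \<in> two_sided_ideal S \<Longrightarrow> v \<in> two_sided_ideal S \<Longrightarrow> u + v \<in> two_sided_ideal S"
| lmult: "u \<in> two_sided_ideal S \<Longrightarrow> x * u \<in> two_sided_ideal S"
| rmult: "u \<in> two_sided_ideal S \<Longrightarrow> u * x \<in> two_sided_ideal S"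

definition su2_relators :: "real \<Rightarrow> free_alg set" where
  "su2_relators q =
    (let a = fgen Ga; b = fgen Gb; c = fgen Gc; d = fgen Gd in
     {b * a - fconst q * (a * b),
      c * a - fconst q * (a * c),
      d * b - fconst q * (b * d),
      d * c - fconst q * (c * d),
      c * b - b * c,
      d * a - a * d - fconst (q * (1 - q powi (-2))) * (b * c),
      a * d - fconst (q powi (-1)) * (b * c) - 1})"


section \<open>The quantum group and its 3D calculus\<close>

text \<open>The index set of the left basis $e^+, e^0, e^-$ of the 1-forms.\<close>

datatype leg = Pl | Ze | Mi

lemma UNIV_leg: "UNIV = {Pl, Ze, Mi}"
  using leg.exhaust by auto

instance leg :: finite
  by standard (simp add: UNIV_leg)

lemma sum_leg: "(\<Sum>i\<in>UNIV. f i) = f Pl + f Ze + f Mi"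
  for f :: "leg \<Rightarrow> 'b::comm_monoid_add"
  by (simp add: UNIV_leg add.assoc)

text \<open>A 1-form $\sum_i x_i e^i$ is its coefficient vector, with left action \<open>*s\<close>.\<close>

type_synonym 'a form = "'a ^ leg"

abbreviation eb :: "leg \<Rightarrow> 'a::ring_1 form" where
  "eb i \<equiv> axis i 1"

text \<open>\<open>coact\<close> takes values in the tensor product of the algebra with the group algebra of the
  integers, modelled as the Laurent polynomials \<^typ>\<open>int \<Rightarrow>\<^sub>0 'a\<close>: there
  \<open>Poly_Mapping.single k x\<close> is $x \otimes z^k$.\<close>

record (overloaded) ('a::ring_1) calculus =
  scal :: "complex \<Rightarrow> 'a \<Rightarrow> 'a"
  gn :: "gen \<Rightarrow> 'a"
  star :: "'a \<Rightarrow> 'a"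
  ract :: "'a form \<Rightarrow> 'a \<Rightarrow> 'a form"
  dif :: "'a \<Rightarrow> 'a form"
  fstar :: "'a form \<Rightarrow> 'a form"
  coact :: "'a \<Rightarrow> (int \<Rightarrow>\<^sub>0 'a)"

definition cst :: "'a::ring_1 calculus \<Rightarrow> complex \<Rightarrow> 'a" where
  "cst X l = scal X l 1"

abbreviation rcst :: "'a::ring_1 calculus \<Rightarrow> real \<Rightarrow> 'a" where
  "rcst X r \<equiv> cst X (complex_of_real r)"

text \<open>The algebra homomorphism from the free algebra sending generators to generators.\<close>

definition eval_free :: "'a::ring_1 calculus \<Rightarrow> free_alg \<Rightarrow> 'a" where
  "eval_free X p =
    (\<Sum>w\<in>Poly_Mapping.keys p. scal X (Poly_Mapping.lookup p w) (prod_list (map (gn X) (letters w))))"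

text \<open>\<open>free_kernel\<close> and \<open>free_surj\<close> say that the algebra is the one presented by the
  generators and relations.\<close>

locale quantum_su2 =
  fixes q :: real and X :: "'a::ring_1 calculus"
  assumes scal_vector_space: "vector_space (scal X)"
    and scal_mult_left: "scal X l (x * y) = scal X l x * y"
    and scal_mult_right: "scal X l (x * y) = x * scal X l y"
    and free_surj: "surj (eval_free X)"
    and free_kernel: "eval_free X p = 0 \<longleftrightarrow> p \<in> two_sided_ideal (su2_relators q)"
    and star_add: "star X (x + y) = star X x + star X y"
    and star_scal: "star X (scal X l x) = scal X (cnj l) (star X x)"
    and star_mult: "star X (x * y) = star X y * star X x"
    and star_star: "star X (star X x) = x"
    and star_a: "star X (gn X Ga) = gn X Gd"
    and star_d: "star X (gn X Gd) = gn X Ga"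
    and star_c: "star X (gn X Gc) = rcst X (- q) * gn X Gb"
    and star_b: "star X (gn X Gb) = rcst X (- (q powi (-1))) * gn X Gc"

fun leg_weight :: "leg \<Rightarrow> int" where
  "leg_weight Pl = 1"
| "leg_weight Ze = 2"
| "leg_weight Mi = 1"

locale quantum_su2_calculus = quantum_su2 +
  assumes ract_add_left: "ract X (\<xi> + \<eta>) x = ract X \<xi> x + ract X \<eta> x"
    and ract_add_right: "ract X \<xi> (x + y) = ract X \<xi> x + ract X \<xi> y"
    and ract_mult: "ract X \<xi> (x * y) = ract X (ract X \<xi> x) y"
    and ract_cst: "ract X \<xi> (cst X l) = cst X l *s \<xi>"
    and ract_left: "ract X (x *s \<xi>) y = x *s ract X \<xi> y"
    and ract_a: "ract X (eb i) (gn X Ga) = (rcst X (q powi leg_weight i) * gn X Ga) *s eb i"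
    and ract_c: "ract X (eb i) (gn X Gc) = (rcst X (q powi leg_weight i) * gn X Gc) *s eb i"
    and ract_b: "ract X (eb i) (gn X Gb) = (rcst X (q powi (- leg_weight i)) * gn X Gb) *s eb i"
    and ract_d: "ract X (eb i) (gn X Gd) = (rcst X (q powi (- leg_weight i)) * gn X Gd) *s eb i"
    and dif_add: "dif X (x + y) = dif X x + dif X y"
    and dif_scal: "dif X (scal X l x) = cst X l *s dif X x"
    and dif_mult: "dif X (x * y) = ract X (dif X x) y + x *s dif X y"
    and dif_a: "dif X (gn X Ga) = gn X Ga *s eb Ze + (rcst X q * gn X Gb) *s eb Pl"
    and dif_b: "dif X (gn X Gb) = gn X Ga *s eb Mi - (rcst X (q powi (-2)) * gn X Gb) *s eb Ze"
    and dif_c: "dif X (gn X Gc) = gn X Gc *s eb Ze + (rcst X q * gn X Gd) *s eb Pl"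
    and dif_d: "dif X (gn X Gd) = gn X Gc *s eb Mi - (rcst X (q powi (-2)) * gn X Gd) *s eb Ze"
    and fstar_add: "fstar X (\<xi> + \<eta>) = fstar X \<xi> + fstar X \<eta>"
    and fstar_scal: "fstar X (cst X l *s \<xi>) = cst X (cnj l) *s fstar X \<xi>"
    and fstar_act: "fstar X (ract X (x *s \<xi>) y) = ract X (star X y *s fstar X \<xi>) (star X x)"
    and fstar_0: "fstar X (eb Ze) = - eb Ze"
    and fstar_p: "fstar X (eb Pl) = rcst X (- (q powi (-1))) *s eb Mi"
    and fstar_m: "fstar X (eb Mi) = rcst X (- q) *s eb Pl"
    and coact_add: "coact X (x + y) = coact X x + coact X y"
    and coact_mult: "coact X (x * y) = coact X x * coact X y"
    and coact_cst: "coact X (cst X l) = Poly_Mapping.single 0 (cst X l)"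
    and coact_a: "coact X (gn X Ga) = Poly_Mapping.single 1 (gn X Ga)"
    and coact_c: "coact X (gn X Gc) = Poly_Mapping.single 1 (gn X Gc)"
    and coact_b: "coact X (gn X Gb) = Poly_Mapping.single (-1) (gn X Gb)"
    and coact_d: "coact X (gn X Gd) = Poly_Mapping.single (-1) (gn X Gd)"


section \<open>The tensor square of the 1-forms over the algebra\<close>

text \<open>As the right-hand tensor factor is left free on the \<open>eb j\<close>, every element of the tensor
  product over the algebra is uniquely $\sum_j T_j \otimes e^j$ with $T_j$ 1-forms; it is
  represented by the family $T$. So \<open>T $ j $ i\<close> is the coefficient of $e^i \otimes e^j$.
  The lemmas \<open>tens_balanced\<close> and \<open>tens_universal\<close> below confirm that this is the
  tensor product.\<close>

type_synonym 'a form2 = "'a form ^ leg"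

definition tens :: "'a::ring_1 calculus \<Rightarrow> 'a form \<Rightarrow> 'a form \<Rightarrow> 'a form2" where
  "tens X \<xi> \<eta> = (\<chi> j. ract X \<xi> (\<eta> $ j))"

definition tlact :: "'a::ring_1 \<Rightarrow> 'a form2 \<Rightarrow> 'a form2" where
  "tlact x T = (\<chi> j. x *s (T $ j))"

definition tract :: "'a::ring_1 calculus \<Rightarrow> 'a form2 \<Rightarrow> 'a \<Rightarrow> 'a form2" where
  "tract X T x = (\<Sum>j\<in>UNIV. tens X (T $ j) (ract X (eb j) x))"

definition tspan :: "'a::ring_1 calculus \<Rightarrow> 'a form set \<Rightarrow> 'a form set \<Rightarrow> 'a form2 set" where
  "tspan X S T = group_closure {tens X \<xi> \<eta> | \<xi> \<eta>. \<xi> \<in> S \<and> \<eta> \<in> T}"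

context quantum_su2_calculus
begin

lemma cst_1 [simp]: "cst X 1 = 1"
  using scal_vector_space by (simp add: cst_def vector_space_def)

lemma cst_0 [simp]: "cst X 0 = 0"
proof -
  interpret vector_space "scal X" by (rule scal_vector_space)
  show ?thesis by (simp add: cst_def)
qed

lemma ract_1 [simp]: "ract X \<xi> 1 = \<xi>"
  using ract_cst[of \<xi> 1] by simp

lemma ract_0_right [simp]: "ract X \<xi> 0 = 0"
  using ract_add_right[of \<xi> 0 0] by simp

lemma ract_sum_right: "ract X \<xi> (sum f S) = (\<Sum>i\<in>S. ract X \<xi> (f i))"
  by (induction S rule: infinite_finite_induct) (simp_all add: ract_add_right)

lemma tens_add_left: "tens X (\<xi> + \<xi>') \<eta> = tens X \<xi> \<eta> + tens X \<xi>' \<eta>"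
  by (simp add: tens_def vec_eq_iff ract_add_left)

lemma tens_add_right: "tens X \<xi> (\<eta> + \<eta>') = tens X \<xi> \<eta> + tens X \<xi> \<eta>'"
  by (simp add: tens_def vec_eq_iff ract_add_right)

lemma tens_balanced: "tens X (ract X \<xi> x) \<eta> = tens X \<xi> (x *s \<eta>)"
  by (simp add: tens_def vec_eq_iff ract_mult)

lemma tens_lact: "tlact x (tens X \<xi> \<eta>) = tens X (x *s \<xi>) \<eta>"
  by (simp add: tens_def tlact_def vec_eq_iff ract_left)

lemma form_expand: "\<eta> = (\<Sum>j\<in>UNIV. (\<eta> $ j) *s eb j)" for \<eta> :: "'a form"
proof -
  have "(\<Sum>j\<in>UNIV. (\<eta> $ j) *s eb j) $ k = \<eta> $ k" for k :: leg
    by (cases k) (simp_all add: sum_leg axis_def)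
  then show ?thesis by (simp add: vec_eq_iff)
qed

lemma form2_expand: "T = (\<Sum>j\<in>UNIV. tens X (T $ j) (eb j))"
proof -
  have "(\<Sum>j\<in>UNIV. tens X (T $ j) (eb j)) $ k = T $ k" for k :: leg
    by (cases k) (simp_all add: sum_leg tens_def axis_def)
  then show ?thesis by (simp add: vec_eq_iff)
qed

lemma tens_ract: "tract X (tens X \<xi> \<eta>) x = tens X \<xi> (ract X \<eta> x)"
proof -
  have sum_r: "tens X \<xi> (sum f S) = (\<Sum>j\<in>S. tens X \<xi> (f j))" for f :: "leg \<Rightarrow> 'a form" and S
    by (simp add: tens_def vec_eq_iff ract_sum_right)
  have sum_l: "ract X (sum f S) x = (\<Sum>j\<in>S. ract X (f j) x)" for f :: "leg \<Rightarrow> 'a form" and S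
  proof (induction S rule: infinite_finite_induct)
    case empty
    show ?case using ract_add_left[of 0 0 x] by simp
  next
    case (infinite S)
    then show ?case using ract_add_left[of 0 0 x] by simp
  qed (simp_all add: ract_add_left)
  have "tract X (tens X \<xi> \<eta>) x = (\<Sum>j\<in>UNIV. tens X \<xi> ((\<eta> $ j) *s ract X (eb j) x))"
    unfolding tract_def by (simp add: tens_def vec_eq_iff ract_mult)
  also have "\<dots> = tens X \<xi> (ract X (\<Sum>j\<in>UNIV. (\<eta> $ j) *s eb j) x)"
    by (simp only: sum_r[symmetric] sum_l ract_left)
  finally show ?thesis using form_expand[of \<eta>] by simp
qed

lemma tens_universal:
  fixes f :: "'a form \<Rightarrow> 'a form \<Rightarrow> 'b::ab_group_add"
  assumes addl: "\<And>\<xi> \<xi>' \<eta>. f (\<xi> + \<xi>') \<eta> = f \<xi> \<eta> + f \<xi>' \<eta>"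
    and addr: "\<And>\<xi> \<eta> \<eta>'. f \<xi> (\<eta> + \<eta>') = f \<xi> \<eta> + f \<xi> \<eta>'"
    and bal: "\<And>\<xi> x \<eta>. f (ract X \<xi> x) \<eta> = f \<xi> (x *s \<eta>)"
  shows "\<exists>!F. Modules.additive F \<and> (\<forall>\<xi> \<eta>. F (tens X \<xi> \<eta>) = f \<xi> \<eta>)"
proof (rule ex1I)
  let ?F = "\<lambda>T. \<Sum>j\<in>UNIV. f (T $ j) (eb j)"
  have "?F (tens X \<xi> \<eta>) = f \<xi> \<eta>" for \<xi> \<eta>
  proof -
    have "?F (tens X \<xi> \<eta>) = f \<xi> (\<Sum>j\<in>UNIV. (\<eta> $ j) *s eb j)"
      by (simp add: tens_def bal sum_leg addr)
    then show ?thesis using form_expand[of \<eta>] by simp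
  qed
  then show "Modules.additive ?F \<and> (\<forall>\<xi> \<eta>. ?F (tens X \<xi> \<eta>) = f \<xi> \<eta>)"
    by (simp add: Modules.additive_def addl sum.distrib)
next
  fix G assume G: "Modules.additive G \<and> (\<forall>\<xi> \<eta>. G (tens X \<xi> \<eta>) = f \<xi> \<eta>)"
  then interpret Modules.additive G by simp
  show "G = (\<lambda>T. \<Sum>j\<in>UNIV. f (T $ j) (eb j))"
  proof
    fix T
    have "G T = G (\<Sum>j\<in>UNIV. tens X (T $ j) (eb j))" using form2_expand[of T] by simp
    also have "\<dots> = (\<Sum>j\<in>UNIV. f (T $ j) (eb j))" using G by (simp add: sum)
    finally show "G T = (\<Sum>j\<in>UNIV. f (T $ j) (eb j))" .
  qed
qed

end


section \<open>2-forms and the exterior derivative\<close>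

text \<open>The left basis $e^+\wedge e^-$, $e^+\wedge e^0$, $e^-\wedge e^0$ of the 2-forms.\<close>

datatype leg2 = PlMi | PlZe | MiZe

lemma UNIV_leg2: "UNIV = {PlMi, PlZe, MiZe}"
  using leg2.exhaust by auto

instance leg2 :: finite
  by standard (simp add: UNIV_leg2)

text \<open>The wedge product is the quotient map of the tensor square by the relations
  \<open>wedge_relators\<close>, written in the above basis; see \<open>wedge_kernel\<close>.\<close>

definition wedge :: "real \<Rightarrow> 'a::ring_1 calculus \<Rightarrow> 'a form2 \<Rightarrow> 'a ^ leg2" where
  "wedge q X T = (\<chi> k. case k of
      PlMi \<Rightarrow> T $ Mi $ Pl - rcst X (q^2) * T $ Pl $ Mi
    | PlZe \<Rightarrow> T $ Ze $ Pl - rcst X (q^4) * T $ Pl $ Ze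
    | MiZe \<Rightarrow> T $ Ze $ Mi - rcst X (q powi (-4)) * T $ Mi $ Ze)"

definition wedge_relators :: "real \<Rightarrow> 'a::ring_1 calculus \<Rightarrow> 'a form2 set" where
  "wedge_relators q X =
    {tens X (eb Pl) (eb Pl), tens X (eb Mi) (eb Mi), tens X (eb Ze) (eb Ze),
     tlact (rcst X (q^2)) (tens X (eb Pl) (eb Mi)) + tens X (eb Mi) (eb Pl),
     tens X (eb Ze) (eb Pl) + tlact (rcst X (q^4)) (tens X (eb Pl) (eb Ze)),
     tens X (eb Ze) (eb Mi) + tlact (rcst X (q powi (-4))) (tens X (eb Mi) (eb Ze))}"

lemma (in quantum_su2_calculus) wedge_surj: "surj (wedge q X)"
proof (rule surjI)
  fix w :: "'a ^ leg2"
  let ?T = "\<chi> j. \<chi> i. (if (i, j) = (Pl, Mi) then w $ PlMi else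
      if (i, j) = (Pl, Ze) then w $ PlZe else if (i, j) = (Mi, Ze) then w $ MiZe else 0)"
  show "wedge q X ?T = w"
    by (auto simp: wedge_def vec_eq_iff split: leg2.split)
qed

lemma (in quantum_su2_calculus) wedge_kernel:
  "wedge q X T = 0 \<longleftrightarrow> T \<in> group_closure {tlact x R | x R. R \<in> wedge_relators q X}"
proof
  let ?N = "group_closure {tlact x R | x R. R \<in> wedge_relators q X}"
  have cst_comm: "cst X l * x = x * cst X l" for l x
    using scal_mult_left[of l 1 x] scal_mult_right[of l x 1] by (simp add: cst_def)
  assume 0: "wedge q X T = 0"
  have w: "T $ Mi $ Pl = rcst X (q^2) * T $ Pl $ Mi" "T $ Ze $ Pl = rcst X (q^4) * T $ Pl $ Ze"
    "T $ Ze $ Mi = rcst X (q powi (-4)) * T $ Mi $ Ze"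
    using 0[unfolded vec_eq_iff, rule_format, of PlMi] 0[unfolded vec_eq_iff, rule_format, of PlZe]
      0[unfolded vec_eq_iff, rule_format, of MiZe] by (simp_all add: wedge_def)
  let ?R1 = "tlact (rcst X (q^2)) (tens X (eb Pl) (eb Mi)) + tens X (eb Mi) (eb Pl)"
  let ?R2 = "tens X (eb Ze) (eb Pl) + tlact (rcst X (q^4)) (tens X (eb Pl) (eb Ze))"
  let ?R3 = "tens X (eb Ze) (eb Mi) + tlact (rcst X (q powi (-4))) (tens X (eb Mi) (eb Ze))"
  have "T $ j $ i = (tlact (T $ Pl $ Pl) (tens X (eb Pl) (eb Pl)) + tlact (T $ Mi $ Mi) (tens X (eb Mi) (eb Mi))
      + tlact (T $ Ze $ Ze) (tens X (eb Ze) (eb Ze)) + tlact (T $ Pl $ Mi) ?R1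
      + tlact (T $ Pl $ Ze) ?R2 + tlact (T $ Mi $ Ze) ?R3) $ j $ i" for i j
    by (cases i; cases j) (simp_all add: tlact_def tens_def axis_def w cst_comm)
  then have T: "T = tlact (T $ Pl $ Pl) (tens X (eb Pl) (eb Pl)) + tlact (T $ Mi $ Mi) (tens X (eb Mi) (eb Mi))
      + tlact (T $ Ze $ Ze) (tens X (eb Ze) (eb Ze)) + tlact (T $ Pl $ Mi) ?R1
      + tlact (T $ Pl $ Ze) ?R2 + tlact (T $ Mi $ Ze) ?R3"
    unfolding vec_eq_iff by blast
  have N: "tlact x R \<in> ?N" if "R \<in> wedge_relators q X" for x R
    using that by (intro group_closure.base) blast
  have "tlact (T $ Pl $ Pl) (tens X (eb Pl) (eb Pl)) + tlact (T $ Mi $ Mi) (tens X (eb Mi) (eb Mi))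
      + tlact (T $ Ze $ Ze) (tens X (eb Ze) (eb Ze)) + tlact (T $ Pl $ Mi) ?R1
      + tlact (T $ Pl $ Ze) ?R2 + tlact (T $ Mi $ Ze) ?R3 \<in> ?N"
    by (intro group_closure_add N; unfold wedge_relators_def; (rule insertI1 | rule insertI2)+)
  then show "T \<in> ?N"
    unfolding T[symmetric] .
next
  have cst_comm: "cst X l * x = x * cst X l" for l x
    using scal_mult_left[of l 1 x] scal_mult_right[of l x 1] by (simp add: cst_def)
  assume "T \<in> group_closure {tlact x R | x R. R \<in> wedge_relators q X}"
  then show "wedge q X T = 0"
  proof (induction T rule: group_closure.induct)
    case (base s)
    then show ?case
      by (auto simp: wedge_relators_def wedge_def vec_eq_iff tlact_def tens_def axis_def cst_comm
          split: leg2.split)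
  next
    case (diff s t)
    have "wedge q X (s - t) = wedge q X s - wedge q X t"
      by (simp add: wedge_def vec_eq_iff algebra_simps split: leg2.split)
    then show ?case using diff by simp
  qed
qed

definition d_basis :: "real \<Rightarrow> 'a::ring_1 calculus \<Rightarrow> leg \<Rightarrow> 'a ^ leg2" where
  "d_basis q X i = (case i of
      Ze \<Rightarrow> rcst X (q^3) *s wedge q X (tens X (eb Pl) (eb Mi))
    | Pl \<Rightarrow> rcst X (- (q^2 * (1 + q powi (-2)))) *s wedge q X (tens X (eb Pl) (eb Ze))
    | Mi \<Rightarrow> rcst X (q powi (-2) * (1 + q powi (-2))) *s wedge q X (tens X (eb Mi) (eb Ze)))"

text \<open>$\mathrm d (\sum_i x_i e^i) = \sum_i (\mathrm d x_i \wedge e^i + x_i\, \mathrm d e^i)$.\<close>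

definition ext_d :: "real \<Rightarrow> 'a::ring_1 calculus \<Rightarrow> 'a form \<Rightarrow> 'a ^ leg2" where
  "ext_d q X \<xi> =
    (\<Sum>i\<in>UNIV. wedge q X (tens X (dif X (\<xi> $ i)) (eb i)) + (\<xi> $ i) *s d_basis q X i)"


section \<open>Horizontal forms and forms on the sphere\<close>

definition horizontal :: "'a::ring_1 form set" where
  "horizontal = {x *s eb Pl + y *s eb Mi | x y. True}"

definition sphere_forms :: "'a::ring_1 calculus \<Rightarrow> 'a form set" where
  "sphere_forms X = {x *s eb Pl + y *s eb Mi | x y.
     coact X x = Poly_Mapping.single (-2) x \<and> coact X y = Poly_Mapping.single 2 y}"


section \<open>Connections\<close>

definition bimodule_map :: "'a::ring_1 calculus \<Rightarrow> ('a form2 \<Rightarrow> 'a form2) \<Rightarrow> bool" where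
  "bimodule_map X \<sigma> \<longleftrightarrow> Modules.additive \<sigma> \<and>
    (\<forall>x T. \<sigma> (tlact x T) = tlact x (\<sigma> T)) \<and> (\<forall>T x. \<sigma> (tract X T x) = tract X (\<sigma> T) x)"

definition bimodule_connection :: "'a::ring_1 calculus \<Rightarrow> ('a form \<Rightarrow> 'a form2) \<Rightarrow> bool" where
  "bimodule_connection X \<D> \<longleftrightarrow>
    Modules.additive \<D> \<and> (\<forall>l \<xi>. \<D> (cst X l *s \<xi>) = tlact (cst X l) (\<D> \<xi>)) \<and>
    (\<forall>x \<xi>. \<D> (x *s \<xi>) = tens X (dif X x) \<xi> + tlact x (\<D> \<xi>)) \<and>
    (\<exists>\<sigma>. bimodule_map X \<sigma> \<and>
      (\<forall>\<xi> x. \<D> (ract X \<xi> x) = tract X (\<D> \<xi>) x + \<sigma> (tens X \<xi> (dif X x))))"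

text \<open>The left invariant, right $\mathbb{CZ}$-invariant bimodule covariant derivative with given
  structure constants.\<close>

definition invariant_connection ::
  "'a::ring_1 calculus \<Rightarrow> ('a form \<Rightarrow> 'a form2) \<Rightarrow>
    complex \<Rightarrow> complex \<Rightarrow> complex \<Rightarrow> complex \<Rightarrow> complex \<Rightarrow> complex \<Rightarrow> complex \<Rightarrow> bool" where
  "invariant_connection X \<D> r \<nu> \<mu> n\<^sub>p n\<^sub>m m\<^sub>p m\<^sub>m \<longleftrightarrow>
    bimodule_connection X \<D> \<and>
    \<D> (eb Ze) = tlact (cst X r) (tens X (eb Ze) (eb Ze))
      + tlact (cst X \<nu>) (tens X (eb Pl) (eb Mi)) + tlact (cst X \<mu>) (tens X (eb Mi) (eb Pl)) \<and>
    \<D> (eb Pl) = tlact (cst X n\<^sub>p) (tens X (eb Ze) (eb Pl)) + tlact (cst X m\<^sub>p) (tens X (eb Pl) (eb Ze)) \<and>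
    \<D> (eb Mi) = tlact (cst X n\<^sub>m) (tens X (eb Ze) (eb Mi)) + tlact (cst X m\<^sub>m) (tens X (eb Mi) (eb Ze))"

definition descends :: "'a::ring_1 calculus \<Rightarrow> ('a form \<Rightarrow> 'a form2) \<Rightarrow> bool" where
  "descends X \<D> \<longleftrightarrow>
    (\<forall>\<xi>\<in>horizontal. \<D> \<xi> \<in> tspan X UNIV horizontal) \<and>
    (\<forall>\<xi>\<in>sphere_forms X. \<D> \<xi> \<in> tspan X horizontal horizontal)"

text \<open>The connections induced on the sphere: restrictions to its 1-forms of the invariant
  connections that descend.\<close>

definition induced_connections :: "'a::ring_1 calculus \<Rightarrow> ('a form \<Rightarrow> 'a form2) set" where
  "induced_connections X = {restrict \<D> (sphere_forms X) | \<D>.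
     (\<exists>r \<nu> \<mu> n\<^sub>p n\<^sub>m m\<^sub>p m\<^sub>m. invariant_connection X \<D> r \<nu> \<mu> n\<^sub>p n\<^sub>m m\<^sub>p m\<^sub>m) \<and> descends X \<D>}"

definition torsion_free_on_sphere ::
  "real \<Rightarrow> 'a::ring_1 calculus \<Rightarrow> ('a form \<Rightarrow> 'a form2) \<Rightarrow> bool" where
  "torsion_free_on_sphere q X D \<longleftrightarrow> (\<forall>\<xi>\<in>sphere_forms X. wedge q X (D \<xi>) = ext_d q X \<xi>)"


section \<open>Hermitian metrics\<close>

text \<open>\<open>herm X g \<xi> \<eta>\<close> is $\langle \xi, \overline{\eta}\rangle$ for the metric
  $\mathrm{diag}(g_{++}, g_{00}, g_{--})$.\<close>

definition diag_metric :: "(leg \<Rightarrow> real) \<Rightarrow> real ^ leg ^ leg" where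
  "diag_metric g = (\<chi> i j. if i = j then g i else 0)"

definition herm :: "'a::ring_1 calculus \<Rightarrow> (leg \<Rightarrow> real) \<Rightarrow> 'a form \<Rightarrow> 'a form \<Rightarrow> 'a" where
  "herm X g \<xi> \<eta> = (\<Sum>i\<in>UNIV. \<Sum>j\<in>UNIV.
     \<xi> $ i * rcst X (matrix_inv (diag_metric g) $ i $ j) * star X (\<eta> $ j))"

text \<open>$(\mathrm{id}\otimes\langle\,,\rangle)(T \otimes \overline\eta)$, using
  $T = \sum_j T_j \otimes e^j$.\<close>

definition herm_right :: "'a::ring_1 calculus \<Rightarrow> (leg \<Rightarrow> real) \<Rightarrow> 'a form2 \<Rightarrow> 'a form \<Rightarrow> 'a form" where
  "herm_right X g T \<eta> = (\<Sum>j\<in>UNIV. ract X (T $ j) (herm X g (eb j) \<eta>))"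

text \<open>$(\langle\,,\rangle\otimes\mathrm{id})(\xi \otimes \overline{\eta_2} \otimes \eta_1^*)$
  for $T = \eta_1 \otimes \eta_2$, summation understood, again using $T = \sum_j T_j \otimes e^j$.\<close>

definition herm_left :: "'a::ring_1 calculus \<Rightarrow> (leg \<Rightarrow> real) \<Rightarrow> 'a form \<Rightarrow> 'a form2 \<Rightarrow> 'a form" where
  "herm_left X g \<xi> T = (\<Sum>j\<in>UNIV. herm X g \<xi> (eb j) *s fstar X (T $ j))"

context quantum_su2_calculus
begin

lemma herm_right_tens: "herm_right X g (tens X \<xi> \<zeta>) \<eta> = ract X \<xi> (herm X g \<zeta> \<eta>)"
proof -
  have h: "herm X g \<zeta> \<eta> = (\<Sum>j\<in>UNIV. \<zeta> $ j * herm X g (eb j) \<eta>)"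
    by (simp add: herm_def sum_leg axis_def algebra_simps)
  show ?thesis
    unfolding herm_right_def h by (simp add: tens_def ract_sum_right ract_mult)
qed

lemma herm_left_tens: "herm_left X g \<xi> (tens X \<eta>\<^sub>1 \<eta>\<^sub>2) = herm X g \<xi> \<eta>\<^sub>2 *s fstar X \<eta>\<^sub>1"
proof -
  have s1: "star X 1 = 1"
    using star_mult[of "star X 1" 1] star_star by simp
  have s0: "star X 0 = 0"
    using star_add[of 0 0] by simp
  have f: "fstar X (ract X \<eta> y) = star X y *s fstar X \<eta>" for \<eta> y
    using fstar_act[of 1 \<eta> y] by (simp add: s1)
  have "herm X g \<xi> \<eta>\<^sub>2 = (\<Sum>j\<in>UNIV. herm X g \<xi> (eb j) * star X (\<eta>\<^sub>2 $ j))"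
    by (simp add: herm_def sum_leg axis_def algebra_simps s0 s1)
  then show ?thesis
    by (simp add: herm_left_def tens_def f sum_leg vec_eq_iff algebra_simps)
qed

end

definition preserves_metric_on_sphere ::
  "'a::ring_1 calculus \<Rightarrow> (leg \<Rightarrow> real) \<Rightarrow> ('a form \<Rightarrow> 'a form2) \<Rightarrow> bool" where
  "preserves_metric_on_sphere X g D \<longleftrightarrow>
    (\<forall>\<xi>\<in>sphere_forms X. \<forall>\<eta>\<in>sphere_forms X.
      dif X (herm X g \<xi> \<eta>) = herm_right X g (D \<xi>) \<eta> + herm_left X g \<xi> (D \<eta>))"

end

theory Submission
  imports Defs
begin

text \<open>The coaction grades the algebra by weight, and on weight $k$ the $e^0$-component of
  $\mathrm d$ is multiplication by $(q^{2k}-1)/(q^2-1)$. So for $x$ of weight $-2$ the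
  $e^0\otimes e^+$-coefficient of $\nabla(xe^+)$ is $n_+-q^{-4}(1+q^2)$ times $x$, and similarly for
  $e^-$ in weight $2$. Descent is the vanishing of these coefficients and of $m_\pm$: the monomials
  $d^2$ and $a^2$ are nonzero because the counit does not kill them. A connection with the required
  values exists since for $m_\pm=0$ a braiding of the form
  $e^i\otimes e^j\mapsto s_{ij}\,e^j\otimes e^i$ works; here $n_\pm$ enters only through
  $\sigma(e^\pm\otimes e^0)$. Metric compatibility follows from $\mathrm d\circ * = *\circ\mathrm d$.\<close>

section \<open>Characters of monoid algebras\<close>

definition monoid_char :: "('w \<Rightarrow> complex) \<Rightarrow> ('w \<Rightarrow>\<^sub>0 complex) \<Rightarrow> complex" where
  "monoid_char \<epsilon> p = (\<Sum>w\<in>Poly_Mapping.keys p. Poly_Mapping.lookup p w * \<epsilon> w)"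

lemma monoid_char_single [simp]: "monoid_char \<epsilon> (Poly_Mapping.single w l) = l * \<epsilon> w"
  by (simp add: monoid_char_def)

lemma monoid_char_zero [simp]: "monoid_char \<epsilon> 0 = 0"
  by (simp add: monoid_char_def)

lemma monoid_char_add [simp]: "monoid_char \<epsilon> (p + r) = monoid_char \<epsilon> p + monoid_char \<epsilon> r"
  unfolding monoid_char_def by (rule setsum_keys_plus_distrib) (simp_all add: distrib_right)

lemma monoid_char_diff [simp]: "monoid_char \<epsilon> (p - r) = monoid_char \<epsilon> p - monoid_char \<epsilon> r"
  using monoid_char_add[of \<epsilon> "p - r" r] by (simp del: monoid_char_add)

lemma poly_mapping_monomial_induct [case_names zero monomial add]:
  assumes "P 0" and single: "\<And>w l. P (Poly_Mapping.single w l)"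
    and add: "\<And>p r. P p \<Longrightarrow> P r \<Longrightarrow> P (p + r)"
  shows "P (p :: 'w \<Rightarrow>\<^sub>0 'c::comm_monoid_add)"
proof (induction p rule: update_induct)
  case const
  then show ?case by fact
next
  case (update f a b)
  \<comment> \<open>\<open>update_induct\<close> only inserts at keys outside the support, so
    nothing is overwritten.\<close>
  have "Poly_Mapping.update a b f = f + Poly_Mapping.single a b"
    using update(1) by (intro poly_mapping_eqI)
      (auto simp: lookup_update lookup_add lookup_single when_def in_keys_iff)
  then show ?case using update add single by simp
qed

lemma monoid_char_mult:
  fixes p r :: "'w::monoid_add \<Rightarrow>\<^sub>0 complex"
  assumes "\<And>u v. \<epsilon> (u + v) = \<epsilon> u * \<epsilon> v"
  shows "monoid_char \<epsilon> (p * r) = monoid_char \<epsilon> p * monoid_char \<epsilon> r"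
proof (induction p rule: poly_mapping_monomial_induct)
  case (monomial w l)
  show ?case
    by (induction r rule: poly_mapping_monomial_induct)
      (simp_all add: assms mult_single distrib_left)
qed (simp_all add: distrib_right)

section \<open>The counit as a character that kills the relator ideal\<close>

lemma two_sided_ideal_char_zero:
  assumes "\<And>u v. h (u * v) = h u * h v" "\<And>u v. h (u + v) = h u + h v" "h 0 = 0"
    and "\<And>s. s \<in> S \<Longrightarrow> h s = (0 :: 'b::ring)" and "u \<in> two_sided_ideal S"
  shows "h u = 0"
  using assms(5) by (induction rule: two_sided_ideal.induct) (simp_all add: assms(1-4))

text \<open>The Hopf algebra counit on words: a and d go to 1, b and c to 0.\<close>

definition counit :: "word \<Rightarrow> complex" where
  "counit w = (if set (letters w) \<subseteq> {Ga, Gd} then 1 else 0)"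

lemma counit_plus: "counit (u + v) = counit u * counit v"
  by (simp add: counit_def plus_word_def)

text \<open>Terms containing b or c are killed; what remains of the last two relators is 1 -
  1.\<close>

lemma counit_su2_relators:
  assumes "s \<in> su2_relators q"
  shows "monoid_char counit s = 0"
proof -
  have [simp]: "counit 0 = 1" "counit (Word [g]) = (if g = Ga \<or> g = Gd then 1 else 0)" for g
    by (simp_all add: counit_def zero_word_def)
  show ?thesis
    using assms by (auto simp: su2_relators_def Let_def fgen_def fconst_def
        monoid_char_mult[OF counit_plus] simp flip: single_one)
qed

lemma counit_ideal: "p \<in> two_sided_ideal (su2_relators q) \<Longrightarrow> monoid_char counit p = 0"
  by (rule two_sided_ideal_char_zero[OF monoid_char_mult[OF counit_plus]])
    (simp_all add: counit_su2_relators)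

lemma matrix_inv_diag_metric:
  assumes "\<And>i. g i \<noteq> 0"
  shows "matrix_inv (diag_metric g) $ i $ j = (if i = j then 1 / g i else 0)"
proof -
  let ?A = "diag_metric g" and ?B = "diag_metric (\<lambda>i. 1 / g i)"
  have "(?A ** ?B) $ i $ j = mat 1 $ i $ j" "(?B ** ?A) $ i $ j = mat 1 $ i $ j" for i j
    using assms by (cases i; cases j; simp add: diag_metric_def matrix_matrix_mult_def mat_def sum_leg)+
  then have AB: "?A ** ?B = mat 1" "?B ** ?A = mat 1"
    unfolding vec_eq_iff by blast+
  \<comment> \<open>\<open>matrix_inv\<close> is defined by choice, so an inverse must be exhibited
    first; its uniqueness then identifies the chosen one with \<open>?B\<close>.\<close>
  then have "\<exists>A'. ?A ** A' = mat 1 \<and> A' ** ?A = mat 1"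
    by blast
  then have inv: "matrix_inv ?A ** ?A = mat 1"
    unfolding matrix_inv_def by (rule someI_ex[THEN conjunct2])
  have "matrix_inv ?A = matrix_inv ?A ** (?A ** ?B)"
    by (simp only: AB matrix_mul_rid)
  also have "\<dots> = ?B"
    by (simp only: matrix_mul_assoc inv matrix_mul_lid)
  finally have "matrix_inv ?A = ?B" .
  then show ?thesis by (simp add: diag_metric_def)
qed

section \<open>The calculus for generic $q$\<close>

fun gen_weight :: "gen \<Rightarrow> int" where
  "gen_weight Ga = 1" | "gen_weight Gc = 1" | "gen_weight Gb = -1" | "gen_weight Gd = -1"

locale generic_su2_calculus = quantum_su2_calculus +
  assumes q_nonzero: "q \<noteq> 0" and q_sq: "q\<^sup>2 \<noteq> 1"
begin

sublocale V: vector_space "scal X"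
  by (rule scal_vector_space)

definition word_prod :: "gen list \<Rightarrow> 'a" where
  "word_prod w = prod_list (map (gn X) w)"

lemma cst_mult_left [simp]: "cst X l * x = scal X l x"
  and cst_mult_right [simp]: "x * cst X l = scal X l x"
  using scal_mult_left[of l 1 x] scal_mult_right[of l x 1] by (simp_all add: cst_def)

lemma scal_simps [simp]: "scal X l x * y = scal X l (x * y)" "x * scal X l y = scal X l (x * y)"
  by (simp_all add: scal_mult_left[symmetric] scal_mult_right[symmetric])

text \<open>By the presentation, a vanishing multiple of a word lies in the relator ideal, where the
  counit is 0; but its counit is \<open>l\<close>. This allows coefficients to be read off without a
  basis of the algebra.\<close>

lemma scal_word_prod_nonzero:
  assumes "counit (Word w) = 1" and "scal X l (word_prod w) = 0"
  shows "l = 0"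
proof -
  have "eval_free X (Poly_Mapping.single (Word w) l) = 0"
    using assms(2) by (cases "l = 0") (simp_all add: eval_free_def word_prod_def)
  then have "monoid_char counit (Poly_Mapping.single (Word w) l) = 0"
    using free_kernel counit_ideal by blast
  then show ?thesis using assms(1) by simp
qed

lemma one_nonzero [simp]: "(1 :: 'a) \<noteq> 0"
  using scal_word_prod_nonzero[of "[]" 1] by (auto simp: word_prod_def counit_def)

lemma alg_induct [case_names add mono]:
  assumes add: "\<And>x y. P x \<Longrightarrow> P y \<Longrightarrow> P (x + y)" and mono: "\<And>l w. P (scal X l (word_prod w))"
  shows "P x"
proof -
  obtain p where p: "x = eval_free X p" using free_surj by blast
  have "P 0" using mono[of 0] by simp
  then have "P (\<Sum>w\<in>S. scal X (f w) (word_prod (letters w)))" for S :: "word set" and f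
    by (induction S rule: infinite_finite_induct) (simp_all add: add mono)
  then show ?thesis unfolding p eval_free_def word_prod_def .
qed

subsection \<open>Coefficients of the right action and of the derivation\<close>

text \<open>The twist in e^i x = phi_i(x) e^i; that the other two coefficients of e^i x vanish is
  \<open>ract_eb\<close>.\<close>

definition phi :: "leg \<Rightarrow> 'a \<Rightarrow> 'a" where
  "phi i x = ract X (eb i) x $ i"

lemma ract_form: "ract X \<xi> x = (\<Sum>i\<in>UNIV. \<xi> $ i *s ract X (eb i) x)"
  by (subst form_expand[of \<xi>]) (simp add: sum_leg ract_add_left ract_left)

lemma ract_scal: "ract X \<xi> (scal X l x) $ i = scal X l (ract X \<xi> x $ i)"
  using ract_mult[of \<xi> "cst X l" x] by (simp add: ract_cst ract_left)

lemma ract_gen: "ract X (eb i) (gn X g) = (rcst X (q powi (gen_weight g * leg_weight i)) * gn X g) *s eb i"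
  by (cases g) (simp_all add: ract_a ract_b ract_c ract_d)

text \<open>Each generator moves past e^i up to a scalar, hence so does each word; additivity in
  \<open>x\<close> does the rest.\<close>

lemma ract_eb: "ract X (eb i) x = phi i x *s eb i"
proof -
  have "ract X (eb i) x $ j = (phi i x *s eb i) $ j" for j
  proof (induction x rule: alg_induct)
    case (add x y)
    then show ?case by (simp add: phi_def ract_add_right distrib_right)
  next
    case (mono l w)
    have "\<exists>y. ract X (eb i) (word_prod w) = y *s eb i"
    proof (induction w)
      case Nil
      show ?case by (auto simp: word_prod_def intro: exI[of _ 1])
    next
      case (Cons g w)
      then obtain y where "ract X (eb i) (word_prod w) = y *s eb i" by blast
      then have "ract X (eb i) (word_prod (g # w)) =
          (rcst X (q powi (gen_weight g * leg_weight i)) * gn X g) *s (y *s eb i)"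
        by (simp add: word_prod_def ract_mult ract_gen ract_left)
      then show ?case
        by (intro exI[of _ "scal X (of_real (q powi (gen_weight g * leg_weight i))) (gn X g * y)"])
          (simp add: vec_eq_iff mult.assoc)
    qed
    then show ?case by (auto simp: phi_def ract_scal axis_def)
  qed
  then show ?thesis by (simp add: vec_eq_iff)
qed

lemma eb_nth: "eb i $ j = (if j = i then 1 else (0 :: 'a))"
  by (simp add: axis_def)

lemma ract_nth [simp]: "ract X \<xi> x $ i = \<xi> $ i * phi i x"
  by (subst ract_form) (cases i; simp add: sum_leg ract_eb eb_nth)

lemma phi_add: "phi i (x + y) = phi i x + phi i y"
  by (simp add: phi_def ract_add_right del: ract_nth)

lemma phi_mult: "phi i (x * y) = phi i x * phi i y"
  using ract_mult[of "eb i" x y] by (simp add: vec_eq_iff) (metis axis_nth mult_1)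

lemma phi_scal [simp]: "phi i (scal X l x) = scal X l (phi i x)"
  by (simp only: phi_def ract_scal)

lemma phi_one [simp]: "phi i 1 = 1"
  by (simp add: phi_def del: ract_nth)

lemma phi_zero [simp]: "phi i 0 = 0"
  by (simp add: phi_def del: ract_nth)

lemma phi_gen: "phi i (gn X g) = scal X (of_real (q powi (gen_weight g * leg_weight i))) (gn X g)"
  by (simp add: phi_def ract_gen del: ract_nth)

lemma dif_mult_nth: "dif X (x * y) $ i = dif X x $ i * phi i y + x * dif X y $ i"
  by (simp add: dif_mult)

lemma dif_scal_nth [simp]: "dif X (scal X l x) $ i = scal X l (dif X x $ i)"
  by (simp add: dif_scal)

lemma dif_zero [simp]: "dif X 0 = 0"
  using dif_add[of 0 0] by simp

lemma phi_minus [simp]: "phi i (- x) = - phi i x"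
  using phi_add[of i x "- x"] by (simp add: eq_neg_iff_add_eq_0 add.commute)

lemma dif_minus [simp]: "dif X (- x) = - dif X x"
  using dif_add[of x "- x"] by (simp add: eq_neg_iff_add_eq_0 add.commute)

lemma dif_one [simp]: "dif X 1 = 0"
  using dif_mult[of 1 1] by simp

subsection \<open>The grading by the circle coaction\<close>

definition homog :: "int \<Rightarrow> 'a \<Rightarrow> bool" where
  "homog k x \<longleftrightarrow> coact X x = Poly_Mapping.single k x"

lemma homog_zero [simp]: "homog k 0"
  using coact_add[of 0 0] by (simp add: homog_def)

lemma homog_one: "homog 0 1"
  using coact_cst[of 1] by (simp add: homog_def)

lemma homog_add: "homog k x \<Longrightarrow> homog k y \<Longrightarrow> homog k (x + y)"
  by (simp add: homog_def coact_add single_add)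

lemma homog_mult: "homog k x \<Longrightarrow> homog l y \<Longrightarrow> homog (k + l) (x * y)"
  by (simp add: homog_def coact_mult mult_single)

lemma homog_scal: "homog k x \<Longrightarrow> homog k (scal X l x)"
  using coact_mult[of "cst X l" x] by (simp add: homog_def coact_cst mult_single)

lemma homog_gen: "homog (gen_weight g) (gn X g)"
  by (cases g) (simp_all add: homog_def coact_a coact_b coact_c coact_d)

abbreviation weight :: "gen list \<Rightarrow> int" where
  "weight w \<equiv> sum_list (map gen_weight w)"

lemma homog_word_prod: "homog (weight w) (word_prod w)"
proof (induction w)
  case Nil
  show ?case by (simp add: word_prod_def homog_one)
next
  case (Cons g w)
  then show ?case using homog_mult[OF homog_gen[of g] Cons] by (simp add: word_prod_def)
qed

lemma homog_sum_induct [case_names add homog]: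
  assumes "\<And>x y. P x \<Longrightarrow> P y \<Longrightarrow> P (x + y)" and "\<And>k x. homog k x \<Longrightarrow> P x"
  shows "P x"
  using assms(1) homog_scal[OF homog_word_prod] assms(2) by (induction x rule: alg_induct) blast+

text \<open>Writing \<open>x\<close> as a sum of words may involve words of the wrong weight. Taking
  the \<open>k\<close>-th coefficient of the coaction discards them and fixes
  \<open>x\<close>.\<close>

lemma homog_induct [consumes 1, case_names add mono]:
  assumes "homog k x" and add: "\<And>x y. P x \<Longrightarrow> P y \<Longrightarrow> P (x + y)"
    and mono: "\<And>l w. weight w = k \<Longrightarrow> P (scal X l (word_prod w))"
  shows "P x"
proof -
  \<comment> \<open>\<open>mono\<close> yields 0 only if some word has weight \<open>k\<close>; a
    power of a or of b is one.\<close>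
  have "P 0"
  proof (cases "\<exists>w. weight w = k")
    case True
    then show ?thesis using mono[of _ 0] by auto
  next
    case False
    have "weight (replicate n g) = int n * gen_weight g" for n g
      by (simp add: sum_list_replicate)
    then have "weight (replicate (nat \<bar>k\<bar>) (if k \<ge> 0 then Ga else Gb)) = k" by auto
    then show ?thesis using False by blast
  qed
  have "P (Poly_Mapping.lookup (coact X y) k)" for y
  proof (induction y rule: alg_induct)
    case (add x y)
    then show ?case by (simp add: coact_add lookup_add assms(2))
  next
    case (mono l w)
    have "coact X (scal X l (word_prod w)) = Poly_Mapping.single (weight w) (scal X l (word_prod w))"
      using homog_scal[OF homog_word_prod] by (simp add: homog_def)
    then show ?case using assms(3) \<open>P 0\<close> by (simp add: lookup_single when_def)
  qed
  from this[of x] show ?thesis using assms(1) by (simp add: homog_def)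
qed

text \<open>The \<open>e\<^sup>0\<close>-component of the derivation acts on weight \<open>k\<close> as the \<open>q\<^sup>2\<close>-integer of \<open>k\<close>.\<close>

definition qint :: "int \<Rightarrow> complex" where
  "qint k = (of_real q powi (2 * k) - 1) / (of_real q ^ 2 - 1)"

lemma qsq_complex: "complex_of_real q ^ 2 \<noteq> 1"
  using q_sq by (metis of_real_eq_1_iff of_real_power)

lemma qint_mult: "qint k * (of_real q ^ 2 - 1) = of_real q powi (2 * k) - 1"
  using qsq_complex by (simp add: qint_def)

text \<open>This is what the Leibniz rule demands of the e^0-component, since e^0 moves past weight
  \<open>l\<close> at the cost of q^(2l).\<close>

lemma qint_add: "qint (k + l) = qint k * of_real q powi (2 * l) + qint l"
  using q_nonzero
  by (simp add: qint_def distrib_left power_int_add left_diff_distrib flip: add_divide_distrib)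

text \<open>Homogeneity bundled with its consequences, so that all of them pass to products
  together. As d preserves weight, the shifts by 2 offset the weights 2 and -2 of e^+ and
  e^-.\<close>

definition graded :: "int \<Rightarrow> 'a \<Rightarrow> bool" where
  "graded k x \<longleftrightarrow> homog k x \<and> (\<forall>i. phi i x = scal X (of_real q powi (k * leg_weight i)) x) \<and>
     dif X x $ Ze = scal X (qint k) x \<and> homog (k - 2) (dif X x $ Pl) \<and> homog (k + 2) (dif X x $ Mi)"

lemma graded_add: "graded k x \<Longrightarrow> graded k y \<Longrightarrow> graded k (x + y)"
  by (simp add: graded_def homog_add phi_add dif_add V.scale_right_distrib)

lemma graded_scal: "graded k x \<Longrightarrow> graded k (scal X l x)"
  by (simp add: graded_def homog_scal mult.commute)

lemma graded_mult:
  assumes "graded k x" "graded l y"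
  shows "graded (k + l) (x * y)"
proof -
  have "homog (k - 2 + l) (dif X x $ Pl * phi Pl y + x * dif X y $ Pl)"
    "homog (k + 2 + l) (dif X x $ Mi * phi Mi y + x * dif X y $ Mi)"
    using assms homog_mult[of "k - 2" _ l] homog_mult[of k _ "l - 2"]
      homog_mult[of "k + 2" _ l] homog_mult[of k _ "l + 2"]
    by (auto simp: graded_def algebra_simps intro!: homog_add homog_scal)
  then show ?thesis using assms q_nonzero
    by (auto simp: graded_def homog_mult phi_mult dif_mult_nth distrib_right power_int_add
        qint_add V.scale_left_distrib algebra_simps)
qed

text \<open>The e^0-coefficients 1 and -q^(-2) in d of the generators are the q^2-integers of 1 and
  -1.\<close>

lemma graded_gen: "graded (gen_weight g) (gn X g)"
proof -
  have 1: "qint 1 = 1" using qsq_complex by (simp add: qint_def)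
  have 2: "qint (-1) = - (of_real q powi (-2))"
    using qsq_complex q_nonzero
    by (simp add: qint_def power_int_minus divide_simps)
  show ?thesis
    using homog_gen[of Ga] homog_gen[of Gb] homog_gen[of Gc] homog_gen[of Gd]
    by (cases g) (simp_all add: graded_def phi_gen dif_a dif_b dif_c dif_d eb_nth 1 2 homog_scal)
qed

lemma graded_word_prod: "graded (weight w) (word_prod w)"
proof (induction w)
  case Nil
  show ?case by (simp add: graded_def word_prod_def homog_one qint_def)
next
  case (Cons g w)
  then show ?case using graded_mult[OF graded_gen[of g] Cons] by (simp add: word_prod_def)
qed

lemma homog_graded: "homog k x \<Longrightarrow> graded k x"
  by (induction rule: homog_induct) (auto simp: graded_add graded_scal graded_word_prod)

lemma phi_homog: "homog k x \<Longrightarrow> phi i x = scal X (of_real q powi (k * leg_weight i)) x"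
  and dif_homog: "homog k x \<Longrightarrow> dif X x $ Ze = scal X (qint k) x"
    "homog k x \<Longrightarrow> homog (k - 2) (dif X x $ Pl)" "homog k x \<Longrightarrow> homog (k + 2) (dif X x $ Mi)"
  using homog_graded by (auto simp: graded_def)

text \<open>On each weight space both maps are scalars. This makes the braiding, which swaps legs, a
  right module map.\<close>

lemma phi_commute: "phi i (phi j x) = phi j (phi i x)"
  by (induction x rule: homog_sum_induct) (simp_all add: phi_add phi_homog mult.commute)

subsection \<open>Compatibility of the derivation with the involution\<close>

lemma star_one: "star X 1 = 1"
  using star_mult[of "star X 1" 1] star_star by simp

lemma star_zero [simp]: "star X 0 = 0"
  using star_add[of 0 0] by simp

lemma fstar_left: "fstar X (x *s \<xi>) = ract X (fstar X \<xi>) (star X x)"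
  using fstar_act[of x \<xi> 1] by (simp add: star_one)

lemma fstar_right: "fstar X (ract X \<xi> x) = star X x *s fstar X \<xi>"
  using fstar_act[of 1 \<xi> x] by (simp add: star_one)

lemma fstar_zero [simp]: "fstar X 0 = 0"
  using fstar_add[of 0 0] by simp

lemma fstar_diff: "fstar X (\<xi> - \<eta>) = fstar X \<xi> - fstar X \<eta>"
  using fstar_add[of "\<xi> - \<eta>" \<eta>] by simp

lemma fstar_dif_gen: "fstar X (dif X (gn X g)) = dif X (star X (gn X g))"
proof -
  have "fstar X (dif X (gn X g)) $ i = dif X (star X (gn X g)) $ i" for i
    using q_nonzero
    by (cases g; cases i)
      (simp_all add: dif_a dif_b dif_c dif_d star_a star_b star_c star_d fstar_add fstar_diff
        fstar_left fstar_0 fstar_p fstar_m eb_nth phi_gen star_scal power_int_minus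
        power2_eq_square divide_simps)
  then show ?thesis by (simp add: vec_eq_iff)
qed

text \<open>From generators this passes to words because star reverses products and thereby swaps
  the two Leibniz terms.\<close>

lemma fstar_dif: "fstar X (dif X x) = dif X (star X x)"
proof (induction x rule: alg_induct)
  case (add x y)
  then show ?case by (simp add: dif_add fstar_add star_add)
next
  case (mono l w)
  have "fstar X (dif X (word_prod w)) = dif X (star X (word_prod w))"
  proof (induction w)
    case Nil
    show ?case by (simp add: word_prod_def star_one)
  next
    case (Cons g w)
    then show ?case
      by (simp add: word_prod_def dif_mult star_mult fstar_add fstar_left fstar_right fstar_dif_gen add.commute)
  qed
  then show ?case by (simp add: dif_scal star_scal fstar_scal)
qed

subsection \<open>Connections with vanishing mixed coefficients\<close>

text \<open>The left Leibniz extension of e^j going to n_j e^0 tensor e^j, for all three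
  legs.\<close>

definition diag_conn :: "(leg \<Rightarrow> complex) \<Rightarrow> 'a form \<Rightarrow> 'a form2" where
  "diag_conn n \<xi> = (\<chi> j. dif X (\<xi> $ j) + scal X (n j) (\<xi> $ j) *s eb Ze)"

text \<open>Solved from sigma(e^i tensor dx) = nabla(e^i x) - nabla(e^i) x. The e^+ and e^-
  coefficients of dx differ in weight from x by -2 and 2, which gives the powers of q; the e^0
  coefficient gives the entry with \<open>n i\<close>.\<close>

definition sigma_coeff :: "(leg \<Rightarrow> complex) \<Rightarrow> leg \<Rightarrow> leg \<Rightarrow> complex" where
  "sigma_coeff n i j = (case j of
      Pl \<Rightarrow> of_real q powi (2 * leg_weight i)
    | Mi \<Rightarrow> of_real q powi (- (2 * leg_weight i))
    | Ze \<Rightarrow> 1 + (1 - of_real q ^ 2) * n i)"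

text \<open>The generalised braiding is \<open>e\<^sup>i \<otimes> e\<^sup>j \<mapsto> s\<^sub>i\<^sub>j e\<^sup>j \<otimes> e\<^sup>i\<close>.\<close>

definition diag_sigma :: "(leg \<Rightarrow> complex) \<Rightarrow> 'a form2 \<Rightarrow> 'a form2" where
  "diag_sigma n T = (\<chi> i j. scal X (sigma_coeff n i j) (T $ j $ i))"

lemma tens_nth [simp]: "tens X \<xi> \<eta> $ j $ i = \<xi> $ i * phi i (\<eta> $ j)"
  by (simp add: tens_def)

lemma tract_nth [simp]: "tract X T x $ j $ i = T $ j $ i * phi i (phi j x)"
  by (cases j) (simp_all add: tract_def sum_leg eb_nth)

lemma tlact_nth [simp]: "tlact x T $ j $ i = x * T $ j $ i"
  by (simp add: tlact_def)

lemma bimodule_map_diag_sigma: "bimodule_map X (diag_sigma n)"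
  by (simp add: bimodule_map_def Modules.additive_def diag_sigma_def vec_eq_iff
      V.scale_right_distrib phi_commute)

text \<open>The braiding identity for e^j and \<open>x\<close>, read off at e^i tensor e^j. Both
  sides are additive in \<open>x\<close>, and on a fixed weight they are multiples of one element,
  so only scalars are compared.\<close>

lemma diag_sigma_dif:
  "scal X (sigma_coeff n j i) (phi j (dif X x $ i)) =
     dif X (phi j x) $ i + (if i = Ze then scal X (n j) (phi j x - phi Ze (phi j x)) else 0)"
proof (induction x rule: homog_sum_induct)
  case (add x y)
  then show ?case
    by (auto simp: dif_add phi_add V.scale_right_distrib V.scale_right_diff_distrib)
next
  case (homog k x)
  note h = phi_homog[OF homog] dif_homog[OF homog] phi_homog[OF dif_homog(2)[OF homog]]
    phi_homog[OF dif_homog(3)[OF homog]]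
  have e: "of_real q powi (2 * m) * of_real q powi ((k - 2) * m) = (of_real q powi (k * m) :: complex)"
    "of_real q powi (- (2 * m)) * of_real q powi ((k + 2) * m) = (of_real q powi (k * m) :: complex)" for m
    using q_nonzero by (simp_all flip: power_int_add add: algebra_simps)
  show ?case
  proof (cases i)
    case Ze
    \<comment> \<open>The defining relation (1 - q^2) [k] = 1 - q^(2k) absorbs the term with
      \<open>n j\<close>.\<close>
    have "(1 + (1 - of_real q ^ 2) * n j) * qint k = qint k + n j * (1 - of_real q powi (2 * k))"
      using arg_cong[OF qint_mult[of k], of "\<lambda>z. n j * z"] by (simp add: algebra_simps)
    from arg_cong[OF this, of "\<lambda>z. scal X (z * of_real q powi (k * leg_weight j)) x"] Ze
    show ?thesis
      by (simp add: h sigma_coeff_def V.scale_left_distrib V.scale_left_diff_distrib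
          V.scale_right_diff_distrib algebra_simps)
  qed (simp_all add: h sigma_coeff_def e)
qed

text \<open>Supplies a connection for every choice of \<open>n\<close>. The braiding condition is
  \<open>diag_sigma_dif\<close> multiplied by the coefficients of the form.\<close>

lemma bimodule_connection_diag_conn: "bimodule_connection X (diag_conn n)"
proof -
  have "Modules.additive (diag_conn n)"
    by (simp add: Modules.additive_def diag_conn_def vec_eq_iff dif_add V.scale_right_distrib distrib_right)
  moreover have "diag_conn n (cst X l *s \<xi>) = tlact (cst X l) (diag_conn n \<xi>)" for l \<xi>
    by (simp add: diag_conn_def vec_eq_iff V.scale_right_distrib mult.commute)
  moreover have "diag_conn n (x *s \<xi>) = tens X (dif X x) \<xi> + tlact x (diag_conn n \<xi>)" for x \<xi>
    by (simp add: diag_conn_def vec_eq_iff dif_mult_nth distrib_left mult.assoc)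
  moreover have "diag_conn n (ract X \<xi> x) = tract X (diag_conn n \<xi>) x + diag_sigma n (tens X \<xi> (dif X x))" for \<xi> x
  proof -
    have "diag_conn n (ract X \<xi> x) $ j $ i =
        (tract X (diag_conn n \<xi>) x + diag_sigma n (tens X \<xi> (dif X x))) $ j $ i" for i j
      using arg_cong[OF diag_sigma_dif[of n j i x], of "\<lambda>y. \<xi> $ j * y"]
      by (simp add: diag_conn_def diag_sigma_def dif_mult_nth distrib_left distrib_right
          right_diff_distrib eb_nth V.scale_right_diff_distrib)
    then show ?thesis by (simp add: vec_eq_iff)
  qed
  ultimately show ?thesis
    unfolding bimodule_connection_def using bimodule_map_diag_sigma by blast
qed

lemma invariant_diag_conn:
  assumes "n Ze = 0"
  shows "invariant_connection X (diag_conn n) 0 0 0 (n Pl) (n Mi) 0 0"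
  using assms
  by (auto simp: invariant_connection_def bimodule_connection_diag_conn diag_conn_def vec_eq_iff eb_nth cst_def)

subsection \<open>Descent to the sphere\<close>

lemma horizontal_iff: "\<xi> \<in> horizontal \<longleftrightarrow> \<xi> $ Ze = 0" for \<xi> :: "'a form"
proof
  assume "\<xi> $ Ze = 0"
  then have "\<xi> $ i = ((\<xi> $ Pl) *s eb Pl + (\<xi> $ Mi) *s eb Mi) $ i" for i
    by (cases i) (simp_all add: eb_nth)
  then have "\<xi> = (\<xi> $ Pl) *s eb Pl + (\<xi> $ Mi) *s eb Mi" unfolding vec_eq_iff by blast
  then show "\<xi> \<in> horizontal" unfolding horizontal_def by blast
qed (auto simp: horizontal_def eb_nth)

lemma sphere_forms_iff:
  "\<xi> \<in> sphere_forms X \<longleftrightarrow> \<xi> $ Ze = 0 \<and> homog (- 2) (\<xi> $ Pl) \<and> homog 2 (\<xi> $ Mi)"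
proof
  assume h: "\<xi> $ Ze = 0 \<and> homog (- 2) (\<xi> $ Pl) \<and> homog 2 (\<xi> $ Mi)"
  then have "\<xi> $ i = ((\<xi> $ Pl) *s eb Pl + (\<xi> $ Mi) *s eb Mi) $ i" for i
    by (cases i) (simp_all add: eb_nth)
  then have "\<xi> = (\<xi> $ Pl) *s eb Pl + (\<xi> $ Mi) *s eb Mi" unfolding vec_eq_iff by blast
  then show "\<xi> \<in> sphere_forms X" using h unfolding sphere_forms_def homog_def by blast
qed (auto simp: sphere_forms_def homog_def eb_nth)

lemma tspan_horizontalI:
  assumes "T $ Ze = 0" "T $ Pl \<in> S" "T $ Mi \<in> S"
  shows "T \<in> tspan X S horizontal"
proof -
  have "T = tens X (T $ Pl) (eb Pl) + tens X (T $ Mi) (eb Mi)"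
    by (subst form2_expand) (use assms(1) in \<open>simp add: sum_leg tens_def vec_eq_iff\<close>)
  moreover have "eb Pl \<in> (horizontal :: 'a form set)" "eb Mi \<in> (horizontal :: 'a form set)"
    by (simp_all add: horizontal_iff eb_nth)
  then have "tens X (T $ Pl) (eb Pl) + tens X (T $ Mi) (eb Mi) \<in> tspan X S horizontal"
    unfolding tspan_def using assms(2,3) by (intro group_closure_add group_closure.base) blast+
  ultimately show ?thesis by simp
qed

lemma tspan_horizontal_iff: "T \<in> tspan X UNIV horizontal \<longleftrightarrow> T $ Ze = 0"
proof
  assume "T \<in> tspan X UNIV horizontal"
  then show "T $ Ze = 0" unfolding tspan_def
    by (induction rule: group_closure.induct) (auto simp: horizontal_iff tens_def)
qed (simp add: tspan_horizontalI)

lemma tspan_horizontal_horizontal_iff: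
  "T \<in> tspan X horizontal horizontal \<longleftrightarrow> T $ Ze = 0 \<and> (\<forall>j. T $ j $ Ze = 0)"
proof
  assume "T \<in> tspan X horizontal horizontal"
  then show "T $ Ze = 0 \<and> (\<forall>j. T $ j $ Ze = 0)" unfolding tspan_def
    by (induction rule: group_closure.induct) (auto simp: horizontal_iff tens_def)
qed (simp add: tspan_horizontalI horizontal_iff)

section \<open>Invariant connections on horizontal forms\<close>

lemma connection_expand:
  assumes "bimodule_connection X \<D>"
  shows "\<D> \<xi> = (\<Sum>i\<in>UNIV. tens X (dif X (\<xi> $ i)) (eb i) + tlact (\<xi> $ i) (\<D> (eb i)))"
proof -
  interpret Modules.additive \<D> using assms by (simp add: bimodule_connection_def)
  have "\<D> \<xi> = (\<Sum>i\<in>UNIV. \<D> ((\<xi> $ i) *s eb i))"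
    unfolding sum[symmetric] by (rule arg_cong[OF form_expand])
  then show ?thesis using assms by (simp add: bimodule_connection_def)
qed

text \<open>A horizontal form has no e^0 term, so the value at e^0, and with it \<open>r\<close>,
  \<open>\<nu>\<close> and \<open>\<mu>\<close>, never contributes.\<close>

lemma invariant_connection_horizontal:
  assumes "invariant_connection X \<D> r \<nu> \<mu> n\<^sub>p n\<^sub>m m\<^sub>p m\<^sub>m" and "\<xi> $ Ze = 0"
  shows "\<D> \<xi> $ Pl = dif X (\<xi> $ Pl) + scal X n\<^sub>p (\<xi> $ Pl) *s eb Ze"
    and "\<D> \<xi> $ Mi = dif X (\<xi> $ Mi) + scal X n\<^sub>m (\<xi> $ Mi) *s eb Ze"
    and "\<D> \<xi> $ Ze = scal X m\<^sub>p (\<xi> $ Pl) *s eb Pl + scal X m\<^sub>m (\<xi> $ Mi) *s eb Mi"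
proof -
  have b: "bimodule_connection X \<D>" using assms(1) by (simp add: invariant_connection_def)
  show "\<D> \<xi> $ Pl = dif X (\<xi> $ Pl) + scal X n\<^sub>p (\<xi> $ Pl) *s eb Ze"
    "\<D> \<xi> $ Mi = dif X (\<xi> $ Mi) + scal X n\<^sub>m (\<xi> $ Mi) *s eb Ze"
    "\<D> \<xi> $ Ze = scal X m\<^sub>p (\<xi> $ Pl) *s eb Pl + scal X m\<^sub>m (\<xi> $ Mi) *s eb Mi"
    using assms unfolding connection_expand[OF b, of \<xi>]
    by (simp_all add: invariant_connection_def vec_eq_iff sum_leg eb_nth)
qed

text \<open>Minus the q^2-integers of -2 and 2, the weights that sphere forms have in front of e^+
  and e^-. The entry at \<open>Ze\<close> is a free choice; 0 makes nabla(e^0) vanish.\<close>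

definition sphere_coeff :: "leg \<Rightarrow> real" where
  "sphere_coeff i = (case i of Pl \<Rightarrow> q powi (-4) * (1 + q\<^sup>2) | Ze \<Rightarrow> 0 | Mi \<Rightarrow> - (1 + q\<^sup>2))"

abbreviation sphere_conn :: "'a form \<Rightarrow> 'a form2" where
  "sphere_conn \<equiv> diag_conn (\<lambda>i. of_real (sphere_coeff i))"

lemma qint_2: "qint 2 = - of_real (sphere_coeff Mi)"
  and qint_minus_2: "qint (- 2) = - of_real (sphere_coeff Pl)"
proof -
  have 4: "(of_real q ^ 2 + 1) * (of_real q ^ 2 - 1) = (of_real q ^ 4 - 1 :: complex)"
    by (simp add: algebra_simps flip: power_add)
  have "qint 2 * (of_real q ^ 2 - 1) = (of_real q ^ 2 + 1) * (of_real q ^ 2 - 1)"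
    unfolding qint_mult 4 by simp
  then show "qint 2 = - of_real (sphere_coeff Mi)"
    using qsq_complex by (simp add: sphere_coeff_def)
  have "of_real q powi (- 4) * of_real q ^ 4 = (1 :: complex)"
    using q_nonzero by (simp add: power_int_minus)
  then have "qint (- 2) * (of_real q ^ 2 - 1) =
      - (of_real q powi (- 4) * ((of_real q ^ 2 + 1) * (of_real q ^ 2 - 1)))"
    unfolding qint_mult 4 by (simp add: right_diff_distrib)
  then have "qint (- 2) * (of_real q ^ 2 - 1) =
      - (of_real q powi (- 4) * (of_real q ^ 2 + 1)) * (of_real q ^ 2 - 1)"
    by (simp only: mult_minus_left mult.assoc)
  then show "qint (- 2) = - of_real (sphere_coeff Pl)"
    using qsq_complex by (simp only: mult_cancel_right) (simp add: sphere_coeff_def)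
qed

lemma invariant_connection_descends_iff:
  assumes inv: "invariant_connection X \<D> r \<nu> \<mu> n\<^sub>p n\<^sub>m m\<^sub>p m\<^sub>m"
  shows "descends X \<D> \<longleftrightarrow> m\<^sub>p = 0 \<and> m\<^sub>m = 0 \<and> n\<^sub>p = of_real (sphere_coeff Pl) \<and> n\<^sub>m = of_real (sphere_coeff Mi)"
proof
  note eqs = invariant_connection_horizontal[OF inv]
  assume d: "descends X \<D>"
  then have "\<D> \<xi> $ Ze = 0" if "\<xi> $ Ze = 0" for \<xi>
    using that by (auto simp: descends_def horizontal_iff tspan_horizontal_iff)
  \<comment> \<open>The forms e^+ and e^- are horizontal, and the coefficients tested here are
    \<open>m\<^sub>p\<close> and \<open>m\<^sub>m\<close>.\<close>
  from this[of "eb Pl"] this[of "eb Mi"] have "\<D> (eb Pl) $ Ze $ Pl = 0" "\<D> (eb Mi) $ Ze $ Mi = 0"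
    by (simp_all add: eb_nth)
  then have m: "m\<^sub>p = 0 \<and> m\<^sub>m = 0"
    by (simp add: eqs eb_nth)
  have z: "\<D> \<xi> $ j $ Ze = 0" if "\<xi> \<in> sphere_forms X" for \<xi> j
    using d that by (auto simp: descends_def tspan_horizontal_horizontal_iff)
  have hd: "homog (- 2) (word_prod [Gd, Gd])" and ha: "homog 2 (word_prod [Ga, Ga])"
    using homog_word_prod[of "[Gd, Gd]"] homog_word_prod[of "[Ga, Ga]"] by simp_all
  \<comment> \<open>Since d^2 has weight -2, d^2 e^+ is a form on the sphere; this is the e^0 tensor
    e^+ coefficient of its covariant derivative. The form a^2 e^- is used likewise below.\<close>
  have "scal X (qint (- 2) + n\<^sub>p) (word_prod [Gd, Gd]) = 0"
    using z[of "word_prod [Gd, Gd] *s eb Pl" Pl]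
    by (simp add: sphere_forms_iff eqs eb_nth hd dif_homog(1)[OF hd] V.scale_left_distrib)
  then have p: "qint (- 2) + n\<^sub>p = 0"
    by (rule scal_word_prod_nonzero[rotated]) (simp add: counit_def)
  have "scal X (qint 2 + n\<^sub>m) (word_prod [Ga, Ga]) = 0"
    using z[of "word_prod [Ga, Ga] *s eb Mi" Mi]
    by (simp add: sphere_forms_iff eqs eb_nth ha dif_homog(1)[OF ha] V.scale_left_distrib)
  then have "qint 2 + n\<^sub>m = 0"
    by (rule scal_word_prod_nonzero[rotated]) (simp add: counit_def)
  with m p show "m\<^sub>p = 0 \<and> m\<^sub>m = 0 \<and> n\<^sub>p = of_real (sphere_coeff Pl) \<and> n\<^sub>m = of_real (sphere_coeff Mi)"
    by (simp add: qint_2 qint_minus_2)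
next
  note eqs = invariant_connection_horizontal[OF inv]
  assume h: "m\<^sub>p = 0 \<and> m\<^sub>m = 0 \<and> n\<^sub>p = of_real (sphere_coeff Pl) \<and> n\<^sub>m = of_real (sphere_coeff Mi)"
  have "\<D> \<xi> $ j $ Ze = 0" if "\<xi> \<in> sphere_forms X" for \<xi> j
    using that h by (cases j) (auto simp: sphere_forms_iff eqs dif_homog qint_2 qint_minus_2)
  then show "descends X \<D>"
    using h by (auto simp: descends_def horizontal_iff tspan_horizontal_iff
        tspan_horizontal_horizontal_iff eqs sphere_forms_iff vec_eq_iff)
qed

section \<open>Existence, uniqueness and torsion of the induced connection\<close>

lemma invariant_sphere_conn:
  "invariant_connection X sphere_conn 0 0 0 (of_real (sphere_coeff Pl)) (of_real (sphere_coeff Mi)) 0 0"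
  by (rule invariant_diag_conn) (simp add: sphere_coeff_def)

lemma descending_connection_eq_sphere_conn:
  assumes inv: "invariant_connection X \<D> r \<nu> \<mu> n\<^sub>p n\<^sub>m m\<^sub>p m\<^sub>m"
    and "descends X \<D>" and "\<xi> \<in> sphere_forms X"
  shows "\<D> \<xi> = sphere_conn \<xi>"
proof -
  have "\<xi> $ Ze = 0" using assms(3) by (simp add: sphere_forms_iff)
  note eqs = invariant_connection_horizontal[OF inv this]
    invariant_connection_horizontal[OF invariant_sphere_conn this]
  have "\<D> \<xi> $ j = sphere_conn \<xi> $ j" for j
    using assms(2) unfolding invariant_connection_descends_iff[OF inv]
    by (cases j) (simp_all add: eqs)
  then show ?thesis by (simp add: vec_eq_iff)
qed

text \<open>\<open>restrict\<close> fixes the values off the sphere forms, so agreement on them is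
  equality of functions; \<open>sphere_conn\<close> itself descends, so the set is nonempty.\<close>

lemma induced_connections_eq: "induced_connections X = {restrict sphere_conn (sphere_forms X)}"
proof
  show "induced_connections X \<subseteq> {restrict sphere_conn (sphere_forms X)}"
    using descending_connection_eq_sphere_conn
    by (auto simp: induced_connections_def intro!: restrict_ext)
  have "descends X sphere_conn"
    by (simp add: invariant_connection_descends_iff[OF invariant_sphere_conn])
  then show "{restrict sphere_conn (sphere_forms X)} \<subseteq> induced_connections X"
    using invariant_sphere_conn unfolding induced_connections_def by blast
qed

text \<open>The terms dx_i wedge e^i occur on both sides, which leaves n_i e^0 wedge e^i = de^i for
  the two horizontal legs. Reordering e^0 wedge e^i by the wedge relations reduces this to
  \<open>coeff\<close>.\<close>

lemma sphere_conn_torsion_free: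
  assumes "\<xi> $ Ze = 0"
  shows "wedge q X (sphere_conn \<xi>) = ext_d q X \<xi>"
proof -
  have coeff: "of_real q ^ 4 * (of_real q powi (- 4) * (1 + of_real q ^ 2)) =
      (of_real q ^ 2 * (1 + of_real q powi (- 2)) :: complex)"
    "of_real q powi (- 4) * (- 1 - of_real q ^ 2) =
      (- (of_real q powi (- 2) * (1 + of_real q powi (- 2))) :: complex)"
    using q_nonzero power_add[of "complex_of_real q" 2 2] by (simp_all add: power_int_minus field_simps)
  have "wedge q X (sphere_conn \<xi>) $ k = ext_d q X \<xi> $ k" for k
    using assms
    by (cases k) (simp_all add: wedge_def ext_d_def d_basis_def sum_leg diag_conn_def eb_nth
        sphere_coeff_def V.scale_right_distrib coeff)
  then show ?thesis by (simp add: vec_eq_iff)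
qed

subsection \<open>Metric compatibility\<close>

lemma fstar_eb_Ze: "fstar X (x *s eb Ze) = - phi Ze (star X x) *s eb Ze"
  by (simp add: fstar_left fstar_0 vec_eq_iff eb_nth)

lemma herm_diag:
  assumes "\<And>i. g i \<noteq> 0"
  shows "herm X g \<xi> \<eta> = (\<Sum>i\<in>UNIV. scal X (of_real (1 / g i)) (\<xi> $ i * star X (\<eta> $ i)))"
  by (simp add: herm_def matrix_inv_diag_metric[OF assms] sum_leg)

text \<open>For real \<open>n\<close> the two contributions of \<open>n\<close> cancel, because \<open>e\<^sup>0\<close> is anti-selfadjoint.\<close>

lemma diag_conn_preserves_metric:
  assumes "\<And>i. g i \<noteq> 0"
  shows "dif X (herm X g \<xi> \<eta>) =
    herm_right X g (diag_conn (\<lambda>i. of_real (n i)) \<xi>) \<eta> + herm_left X g \<xi> (diag_conn (\<lambda>i. of_real (n i)) \<eta>)"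
proof -
  have "dif X (herm X g \<xi> \<eta>) $ k = (herm_right X g (diag_conn (\<lambda>i. of_real (n i)) \<xi>) \<eta>
     + herm_left X g \<xi> (diag_conn (\<lambda>i. of_real (n i)) \<eta>)) $ k" for k
    by (simp add: herm_diag[OF assms] herm_right_def herm_left_def diag_conn_def sum_leg eb_nth
        dif_add dif_mult_nth fstar_add fstar_dif fstar_eb_Ze star_one star_scal phi_add
        V.scale_right_distrib algebra_simps)
  then show ?thesis by (simp add: vec_eq_iff)
qed

end

theorem mainTheorem7:
  fixes q :: real and X :: "'a::ring_1 calculus"
  assumes "q \<noteq> 0" and "q\<^sup>2 \<noteq> 1" and "quantum_su2_calculus q X"
  shows "(\<forall>\<D> r \<nu> \<mu> n\<^sub>p n\<^sub>m m\<^sub>p m\<^sub>m. invariant_connection X \<D> r \<nu> \<mu> n\<^sub>p n\<^sub>m m\<^sub>p m\<^sub>m \<longrightarrow>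
           (descends X \<D> \<longleftrightarrow>
              \<D> (eb Pl) = tlact (cst X n\<^sub>p) (tens X (eb Ze) (eb Pl)) \<and>
              \<D> (eb Mi) = tlact (cst X n\<^sub>m) (tens X (eb Ze) (eb Mi)) \<and>
              n\<^sub>m = complex_of_real (- (1 + q\<^sup>2)) \<and>
              n\<^sub>p = complex_of_real (q powi (-4) * (1 + q\<^sup>2)))) \<and>
         (\<exists>!D. D \<in> induced_connections X) \<and>
         (\<forall>D\<in>induced_connections X.
            torsion_free_on_sphere q X D \<and>
            (\<forall>g. (\<forall>i. g i \<noteq> 0) \<longrightarrow> preserves_metric_on_sphere X g D))"
proof (intro conjI allI impI)
  interpret generic_su2_calculus q X
    using assms by (simp add: generic_su2_calculus_def generic_su2_calculus_axioms_def)
  show "descends X \<D> \<longleftrightarrow>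
      \<D> (eb Pl) = tlact (cst X n\<^sub>p) (tens X (eb Ze) (eb Pl)) \<and>
      \<D> (eb Mi) = tlact (cst X n\<^sub>m) (tens X (eb Ze) (eb Mi)) \<and>
      n\<^sub>m = complex_of_real (- (1 + q\<^sup>2)) \<and> n\<^sub>p = complex_of_real (q powi (-4) * (1 + q\<^sup>2))"
    if inv: "invariant_connection X \<D> r \<nu> \<mu> n\<^sub>p n\<^sub>m m\<^sub>p m\<^sub>m" for \<D> r \<nu> \<mu> n\<^sub>p n\<^sub>m m\<^sub>p m\<^sub>m
  proof -
    \<comment> \<open>The theorem expresses the vanishing of \<open>m\<^sub>p\<close> and
      \<open>m\<^sub>m\<close> through the shape of nabla(e^+) and nabla(e^-); this translates
      between the two.\<close>
    have tlact_0: "tlact (cst X m) (tens X (eb i) (eb Ze)) = 0 \<longleftrightarrow> m = 0" for m i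
    proof
      assume "tlact (cst X m) (tens X (eb i) (eb Ze)) = 0"
      then have "tlact (cst X m) (tens X (eb i) (eb Ze)) $ Ze $ i = 0" by simp
      then show "m = 0" by (simp add: cst_def)
    qed (simp add: vec_eq_iff)
    show ?thesis
      using inv unfolding invariant_connection_descends_iff[OF inv]
      by (auto simp: invariant_connection_def tlact_0 sphere_coeff_def)
  qed
  show "\<exists>!D. D \<in> induced_connections X"
    by (simp add: induced_connections_eq)
  show "\<forall>D\<in>induced_connections X. torsion_free_on_sphere q X D \<and>
      (\<forall>g. (\<forall>i. g i \<noteq> 0) \<longrightarrow> preserves_metric_on_sphere X g D)"
    by (auto simp: induced_connections_eq torsion_free_on_sphere_def preserves_metric_on_sphere_def
        sphere_conn_torsion_free diag_conn_preserves_metric sphere_forms_iff)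
qed

end
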